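(* Let $I\subset\mathbb{R}$ be an open interval and let $f,h:I\to\mathbb{R}$ be smooth functions with $f(u)\neq0$ and $f'(u)^2+h'(u)^2>0$ for all $u\in I$. Let $M^2$ be the surface of revolution parametrized by $\phi:I\times(0,2\pi)\to\mathbb{R}^3$, $\phi(u,v)=(f(u)\sin v,f(u)\cos v,h(u))$, with the induced metric $g=(f'(u)^2+h'(u)^2)\,du^2+f(u)^2\,dv^2$. If the coordinate vector fields $\frac{\partial}{\partial u}$ and $\frac{\partial}{\partial v}$ are both harmonic sections on $(M^2,g)$, then the Gaussian curvature of $(M^2,g)$ is identically zero.
   Context: A smooth vector field $X$ on a Riemannian manifold $(M,g)$ with Levi-Civita connection $\nabla$ is called a harmonic section if its rough Laplacian vanishes: $\Delta X=\operatorname{Tr}_g\nabla^2X=\sum_i\left(\nabla_{e_i}\nabla_{e_i}X-\nabla_{\nabla_{e_i}e_i}X\right)=0$, where $\{e_i\}$ is any local orthonormal frame. The fields $\frac{\partial}{\partial u},\frac{\partial}{\partial v}$ are the coordinate vector fields of the parametrization $\phi$; equivalently one may work on $I\times(0,2\pi)$ with the metric $g$. *)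

theory Defs
  imports "HOL-Analysis.Analysis"
begin

section \<open>Smooth maps\<close>

primrec higher_differentiable_on ::
  "'a::real_normed_vector set \<Rightarrow> ('a \<Rightarrow> 'b::real_normed_vector) \<Rightarrow> nat \<Rightarrow> bool" where
  "higher_differentiable_on S f 0 \<longleftrightarrow> continuous_on S f"
| "higher_differentiable_on S f (Suc n) \<longleftrightarrow>
     (\<forall>x\<in>S. f differentiable (at x)) \<and>
     (\<forall>v. higher_differentiable_on S (\<lambda>x. frechet_derivative f (at x) v) n)"

text \<open>Meant for finite-dimensional domains and open \<^term>\<open>S\<close>, where it is the usual
  $C^\infty$ condition.\<close>

definition smooth_on :: "'a::real_normed_vector set \<Rightarrow> ('a \<Rightarrow> 'b::real_normed_vector) \<Rightarrow> bool" where
  "smooth_on S f \<longleftrightarrow> (\<forall>n. higher_differentiable_on S f n)"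

section \<open>Riemannian geometry in a coordinate chart\<close>

text \<open>A chart is an open set of \<open>real ^ 'n\<close>. A metric is given by its Gram matrices
  $g_{ij} = g(\partial_i,\partial_j)$, a vector field by its components with respect to the
  coordinate fields $\partial_i$. All operators below are local, so their values at points of the
  chart do not depend on how these functions are extended outside it.\<close>

type_synonym 'n metric = "real ^ 'n \<Rightarrow> real ^ 'n ^ 'n"
type_synonym 'n vfield = "real ^ 'n \<Rightarrow> real ^ 'n"

definition partial :: "'n::finite \<Rightarrow> (real ^ 'n \<Rightarrow> 'b::real_normed_vector) \<Rightarrow> real ^ 'n \<Rightarrow> 'b" where
  "partial i F p = frechet_derivative F (at p) (axis i 1)"

definition coord_field :: "'n::finite \<Rightarrow> 'n vfield" where
  "coord_field i = (\<lambda>p. axis i 1)"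

definition metric_inner :: "'n::finite metric \<Rightarrow> real ^ 'n \<Rightarrow> real ^ 'n \<Rightarrow> real ^ 'n \<Rightarrow> real" where
  "metric_inner g p v w = (\<Sum>i\<in>UNIV. \<Sum>j\<in>UNIV. g p $ i $ j * v $ i * w $ j)"

definition riemannian_metric_on :: "(real ^ 'n::finite) set \<Rightarrow> 'n metric \<Rightarrow> bool" where
  "riemannian_metric_on U g \<longleftrightarrow> smooth_on U g \<and>
     (\<forall>p\<in>U. transpose (g p) = g p \<and> (\<forall>v. v \<noteq> 0 \<longrightarrow> 0 < metric_inner g p v v))"

text \<open>\<open>christoffel g p k i j\<close> is $\Gamma^k_{ij}(p)$.\<close>

definition christoffel :: "'n::finite metric \<Rightarrow> real ^ 'n \<Rightarrow> 'n \<Rightarrow> 'n \<Rightarrow> 'n \<Rightarrow> real" where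
  "christoffel g p k i j = (1/2) * (\<Sum>l\<in>UNIV. matrix_inv (g p) $ k $ l *
     (partial i (\<lambda>q. g q $ j $ l) p + partial j (\<lambda>q. g q $ i $ l) p
       - partial l (\<lambda>q. g q $ i $ j) p))"

text \<open>\<open>levi_civita g X Y\<close> is $\nabla_X Y$.\<close>

definition levi_civita :: "'n::finite metric \<Rightarrow> 'n vfield \<Rightarrow> 'n vfield \<Rightarrow> 'n vfield" where
  "levi_civita g X Y = (\<lambda>p. frechet_derivative Y (at p) (X p) +
     (\<chi> k. \<Sum>i\<in>UNIV. \<Sum>j\<in>UNIV. christoffel g p k i j * X p $ i * Y p $ j))"

text \<open>\<open>second_cov g Y Z X\<close> is $\nabla^2_{Y,Z} X = \nabla_Y \nabla_Z X - \nabla_{\nabla_Y Z} X$.\<close>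

definition second_cov :: "'n::finite metric \<Rightarrow> 'n vfield \<Rightarrow> 'n vfield \<Rightarrow> 'n vfield \<Rightarrow> 'n vfield" where
  "second_cov g Y Z X = (\<lambda>p. levi_civita g Y (levi_civita g Z X) p
     - levi_civita g (levi_civita g Y Z) X p)"

text \<open>The trace $\mathrm{Tr}_g \nabla^2 X = g^{ij} \nabla^2_{\partial_i,\partial_j} X$; see
  \<open>rough_laplacian_orthonormal_frame\<close> below for the expression in an orthonormal frame.\<close>

definition rough_laplacian :: "'n::finite metric \<Rightarrow> 'n vfield \<Rightarrow> 'n vfield" where
  "rough_laplacian g X = (\<lambda>p. \<Sum>i\<in>UNIV. \<Sum>j\<in>UNIV.
     matrix_inv (g p) $ i $ j *\<^sub>R second_cov g (coord_field i) (coord_field j) X p)"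

definition harmonic_section :: "(real ^ 'n::finite) set \<Rightarrow> 'n metric \<Rightarrow> 'n vfield \<Rightarrow> bool" where
  "harmonic_section U g X \<longleftrightarrow> smooth_on U X \<and> (\<forall>p\<in>U. rough_laplacian g X p = 0)"

definition lie_bracket :: "'n::finite vfield \<Rightarrow> 'n vfield \<Rightarrow> 'n vfield" where
  "lie_bracket X Y = (\<lambda>p. frechet_derivative Y (at p) (X p) - frechet_derivative X (at p) (Y p))"

text \<open>Sign convention: $R(X,Y)Z = \nabla_X\nabla_Y Z - \nabla_Y\nabla_X Z - \nabla_{[X,Y]}Z$, so
  that the round sphere has positive curvature below.\<close>

definition riemann_curvature ::
  "'n::finite metric \<Rightarrow> 'n vfield \<Rightarrow> 'n vfield \<Rightarrow> 'n vfield \<Rightarrow> 'n vfield" where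
  "riemann_curvature g X Y Z = (\<lambda>p. levi_civita g X (levi_civita g Y Z) p
     - levi_civita g Y (levi_civita g X Z) p - levi_civita g (lie_bracket X Y) Z p)"

definition gaussian_curvature :: "2 metric \<Rightarrow> real ^ 2 \<Rightarrow> real" where
  "gaussian_curvature g p =
     metric_inner g p
       (riemann_curvature g (coord_field 1) (coord_field 2) (coord_field 2) p) (coord_field 1 p)
     / (g p $ 1 $ 1 * g p $ 2 $ 2 - (g p $ 1 $ 2)\<^sup>2)"

section \<open>Surfaces of revolution\<close>

definition induced_metric :: "(real ^ 'n::finite \<Rightarrow> 'b::real_inner) \<Rightarrow> 'n metric" where
  "induced_metric \<phi> = (\<lambda>p. \<chi> i j. partial i \<phi> p \<bullet> partial j \<phi> p)"

text \<open>The coordinates are \<open>u = p $ 1\<close> and \<open>v = p $ 2\<close>.\<close>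

definition revolution_domain :: "real set \<Rightarrow> (real ^ 2) set" where
  "revolution_domain I = {p. p $ 1 \<in> I \<and> 0 < p $ 2 \<and> p $ 2 < 2 * pi}"

definition surface_of_revolution :: "(real \<Rightarrow> real) \<Rightarrow> (real \<Rightarrow> real) \<Rightarrow> real ^ 2 \<Rightarrow> real ^ 3" where
  "surface_of_revolution f h p =
     vector [f (p $ 1) * sin (p $ 2), f (p $ 1) * cos (p $ 2), h (p $ 1)]"

section \<open>Consistency of the definitions\<close>

lemma induced_metric_surface_of_revolution:
  assumes "f differentiable (at (p $ 1))" "h differentiable (at (p $ 1))"
  shows "induced_metric (surface_of_revolution f h) p =
    vector [vector [(deriv f (p $ 1))\<^sup>2 + (deriv h (p $ 1))\<^sup>2, 0], vector [0, (f (p $ 1))\<^sup>2]]"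
proof -
  let ?u = "p $ 1" and ?v = "p $ 2"
  have c: "((\<lambda>q::real^2. q $ i) has_derivative (\<lambda>w. w $ i)) (at p)" for i
    by (intro bounded_linear_imp_has_derivative bounded_linear_vec_nth)
  have df: "(f has_derivative (*) (deriv f ?u)) (at ?u)"
    and dh: "(h has_derivative (*) (deriv h ?u)) (at ?u)"
    using assms by (auto simp: DERIV_deriv_iff_real_differentiable[symmetric]
        has_field_derivative_def)
  have f': "((\<lambda>q::real^2. f (q $ 1)) has_derivative (\<lambda>w. deriv f ?u * w $ 1)) (at p)"
    using has_derivative_compose[OF c df] by simp
  have h': "((\<lambda>q::real^2. h (q $ 1)) has_derivative (\<lambda>w. deriv h ?u * w $ 1)) (at p)"
    using has_derivative_compose[OF c dh] by simp
  define D :: "real^2 \<Rightarrow> real^3" where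
    "D = (\<lambda>w. vector [deriv f ?u * w $ 1 * sin ?v + f ?u * (cos ?v * w $ 2),
       deriv f ?u * w $ 1 * cos ?v - f ?u * (sin ?v * w $ 2), deriv h ?u * w $ 1])"
  have s: "((\<lambda>q::real^2. f (q $ 1) * sin (q $ 2)) has_derivative
      (\<lambda>w. deriv f ?u * w $ 1 * sin ?v + f ?u * (cos ?v * w $ 2))) (at p)"
    by (rule has_derivative_eq_rhs, rule has_derivative_mult[OF f' has_derivative_sin[OF c]])
       (auto simp: algebra_simps)
  have co: "((\<lambda>q::real^2. f (q $ 1) * cos (q $ 2)) has_derivative
      (\<lambda>w. deriv f ?u * w $ 1 * cos ?v - f ?u * (sin ?v * w $ 2))) (at p)"
    by (rule has_derivative_eq_rhs, rule has_derivative_mult[OF f' has_derivative_cos[OF c]])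
       (auto simp: algebra_simps)
  have comp: "((\<lambda>q. surface_of_revolution f h q $ i) has_derivative (\<lambda>w. D w $ i)) (at p)" for i
    using exhaust_3[of i] s co h' by (auto simp: surface_of_revolution_def D_def)
  have "(surface_of_revolution f h has_derivative D) (at p)"
    unfolding has_derivative_componentwise_within[of _ D]
    using comp by (auto simp: Basis_vec_def inner_axis)
  then have "partial i (surface_of_revolution f h) p = D (axis i 1)" for i
    by (simp add: partial_def frechet_derivative_at[symmetric])
  moreover have "(deriv f ?u * cos ?v)\<^sup>2 + (deriv f ?u * sin ?v)\<^sup>2 = (deriv f ?u)\<^sup>2"
    "(f ?u * cos ?v)\<^sup>2 + (f ?u * sin ?v)\<^sup>2 = (f ?u)\<^sup>2"
    by (simp_all add: power_mult_distrib flip: distrib_left)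
  ultimately show ?thesis
    by (simp add: induced_metric_def vec_eq_iff forall_2 D_def inner_vec_def sum_3 axis_def
        power2_eq_square algebra_simps)
qed

lemma sum_axis:
  fixes c :: "'n::finite \<Rightarrow> 'm::finite \<Rightarrow> real"
  shows "(\<Sum>i\<in>UNIV. \<Sum>j\<in>UNIV. c i j * axis l 1 $ i * w j) = (\<Sum>j\<in>UNIV. c l j * w j)"
proof -
  have "(\<Sum>i\<in>UNIV. \<Sum>j\<in>UNIV. c i j * axis l 1 $ i * w j)
     = (\<Sum>i\<in>UNIV. if i = l then \<Sum>j\<in>UNIV. c i j * w j else 0)"
    by (rule sum.cong) (auto simp: axis_def)
  then show ?thesis by simp
qed

lemma sum_axis':
  fixes c :: "'m::finite \<Rightarrow> real"
  shows "(\<Sum>j\<in>UNIV. c j * axis l 1 $ j) = c l"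
proof -
  have "(\<Sum>j\<in>UNIV. c j * axis l 1 $ j) = (\<Sum>j\<in>UNIV. if j = l then c j else 0)"
    by (rule sum.cong) (auto simp: axis_def)
  then show ?thesis by simp
qed

lemma levi_civita_coord:
  assumes "X differentiable (at p)"
  shows "levi_civita g Z X p = (\<Sum>j\<in>UNIV. Z p $ j *\<^sub>R levi_civita g (coord_field j) X p)"
proof -
  interpret linear "frechet_derivative X (at p)"
    using assms by (rule linear_frechet_derivative)
  have "frechet_derivative X (at p) (Z p)
      = (\<Sum>j\<in>UNIV. Z p $ j *\<^sub>R frechet_derivative X (at p) (axis j 1))"
    by (subst basis_expansion[of "Z p", symmetric])
       (simp add: sum scale scalar_mult_eq_scaleR)
  moreover have "(\<Sum>i\<in>UNIV. \<Sum>j\<in>UNIV. christoffel g p k i j * axis l 1 $ i * X p $ j)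
     = (\<Sum>j\<in>UNIV. christoffel g p k l j * X p $ j)" for k l
    by (rule sum_axis)
  ultimately show ?thesis
    by (simp add: levi_civita_def coord_field_def vec_eq_iff scaleR_add_right sum.distrib
         sum_distrib_left mult_ac)
qed

lemma second_cov_coord:
  assumes U: "open U" "p \<in> U"
    and X: "\<And>q. q \<in> U \<Longrightarrow> X differentiable (at q)"
    and A: "\<And>j. levi_civita g (coord_field j) X differentiable (at p)"
    and Z: "Z differentiable (at p)"
  shows "second_cov g Y Z X p = (\<Sum>i\<in>UNIV. \<Sum>j\<in>UNIV.
     (Y p $ i * Z p $ j) *\<^sub>R second_cov g (coord_field i) (coord_field j) X p)"
proof -
  define A where "A = (\<lambda>j. levi_civita g (coord_field j) X)"
  define G where "G = (\<lambda>v w. (\<chi> k. \<Sum>i\<in>UNIV. \<Sum>j\<in>UNIV. christoffel g p k i j * v $ i * w $ j))"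
  have dA: "A j differentiable (at p)" for j using assms(4) by (simp add: A_def)
  have "linear (G v)" for v
    by (rule linearI) (simp_all add: G_def vec_eq_iff sum.distrib sum_distrib_left distrib_left mult_ac)
  then have Gs: "G v (\<Sum>j\<in>UNIV. c j *\<^sub>R W j) = (\<Sum>j\<in>UNIV. c j *\<^sub>R G v (W j))"
    for v c and W :: "'a \<Rightarrow> _"
    by (simp add: linear_sum linear_scale)
  have Ga: "G (axis i 1) (axis j 1) $ k = christoffel g p k i j" for i j k
    unfolding G_def by (simp add: sum_axis sum_axis')
  have GG: "G v w = (\<Sum>i\<in>UNIV. \<Sum>j\<in>UNIV. (v $ i * w $ j) *\<^sub>R G (axis i 1) (axis j 1))" for v w
    unfolding vec_eq_iff sum_component vector_scaleR_component Ga by (simp add: G_def mult_ac)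
  have lc: "levi_civita g Y F p = frechet_derivative F (at p) (Y p) + G (Y p) (F p)" for Y F
    by (simp add: levi_civita_def G_def)
  have locX: "levi_civita g W X q = (\<Sum>j\<in>UNIV. W q $ j *\<^sub>R A j q)" if "q \<in> U" for W q
    unfolding A_def by (rule levi_civita_coord[OF X[OF that]])
  have fd: "frechet_derivative (levi_civita g W X) (at p) v =
     (\<Sum>j\<in>UNIV. W p $ j *\<^sub>R frechet_derivative (A j) (at p) v
        + (frechet_derivative W (at p) v) $ j *\<^sub>R A j p)" if W: "W differentiable (at p)" for W v
  proof -
    have "((\<lambda>q. \<Sum>j\<in>UNIV. W q $ j *\<^sub>R A j q) has_derivative
       (\<lambda>v. \<Sum>j\<in>UNIV. W p $ j *\<^sub>R frechet_derivative (A j) (at p) v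
        + (frechet_derivative W (at p) v) $ j *\<^sub>R A j p)) (at p)"
      using W dA by (auto intro!: has_derivative_sum has_derivative_scaleR
        bounded_linear.has_derivative[OF bounded_linear_vec_nth] simp: frechet_derivative_works)
    then have "(levi_civita g W X has_derivative
       (\<lambda>v. \<Sum>j\<in>UNIV. W p $ j *\<^sub>R frechet_derivative (A j) (at p) v
        + (frechet_derivative W (at p) v) $ j *\<^sub>R A j p)) (at p)"
      by (rule has_derivative_transform_within_open[OF _ U]) (simp add: locX)
    then show ?thesis by (simp add: frechet_derivative_at[symmetric])
  qed
  have main: "second_cov g V W X p = (\<Sum>j\<in>UNIV. W p $ j *\<^sub>R levi_civita g V (A j) p)
      - (\<Sum>j\<in>UNIV. G (V p) (W p) $ j *\<^sub>R A j p)" if W: "W differentiable (at p)" for V W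
  proof -
    have "levi_civita g V (levi_civita g W X) p = (\<Sum>j\<in>UNIV. W p $ j *\<^sub>R levi_civita g V (A j) p)
        + (\<Sum>j\<in>UNIV. frechet_derivative W (at p) (V p) $ j *\<^sub>R A j p)"
      unfolding lc[of V "levi_civita g W X"] fd[OF W] locX[OF U(2), of W] Gs
      by (simp add: lc[of V "A _"] sum.distrib scaleR_add_right)
    moreover have "levi_civita g (levi_civita g V W) X p =
        (\<Sum>j\<in>UNIV. frechet_derivative W (at p) (V p) $ j *\<^sub>R A j p)
        + (\<Sum>j\<in>UNIV. G (V p) (W p) $ j *\<^sub>R A j p)"
      unfolding locX[OF U(2), of "levi_civita g V W"] lc[of V W]
      by (simp add: sum.distrib scaleR_add_left)
    ultimately show ?thesis by (simp add: second_cov_def)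
  qed
  have dc: "coord_field j differentiable (at p)" for j by (simp add: coord_field_def)
  have sc: "second_cov g (coord_field i) (coord_field j) X p = levi_civita g (coord_field i) (A j) p
      - (\<Sum>k\<in>UNIV. G (axis i 1) (axis j 1) $ k *\<^sub>R A k p)" for i j
    unfolding main[OF dc]
    by (simp add: coord_field_def axis_def if_distrib[of "\<lambda>x. x *\<^sub>R _"] cong: if_cong)
  have 1: "(\<Sum>j\<in>UNIV. Z p $ j *\<^sub>R levi_civita g Y (A j) p) =
    (\<Sum>i\<in>UNIV. \<Sum>j\<in>UNIV. (Y p $ i * Z p $ j) *\<^sub>R levi_civita g (coord_field i) (A j) p)"
    by (subst sum.swap) (simp add: levi_civita_coord[OF dA, of g Y] scaleR_sum_right mult_ac)
  have 2: "(\<Sum>k\<in>UNIV. G (Y p) (Z p) $ k *\<^sub>R A k p) =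
    (\<Sum>i\<in>UNIV. \<Sum>j\<in>UNIV. (Y p $ i * Z p $ j) *\<^sub>R (\<Sum>k\<in>UNIV. G (axis i 1) (axis j 1) $ k *\<^sub>R A k p))"
    apply (subst GG)
    apply (simp add: scaleR_sum_right scaleR_sum_left sum_component)
    apply (rule trans[OF sum.swap])
    apply (rule sum.cong[OF refl])
    apply (rule sum.swap)
    done
  show ?thesis unfolding main[OF Z] sc 1 2 by (simp add: scaleR_diff_right sum_subtractf)
qed

lemma matrix_inv_left:
  fixes M :: "real ^ 'n::finite ^ 'n"
  assumes "invertible M" shows "matrix_inv M ** M = mat 1"
  using assms someI_ex[of "\<lambda>M'. M ** M' = mat 1 \<and> M' ** M = mat 1"]
  by (auto simp: invertible_def matrix_inv_def)

lemma matrix_inv_right: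
  fixes M :: "real ^ 'n::finite ^ 'n"
  assumes "invertible M" shows "M ** matrix_inv M = mat 1"
  using matrix_inv_left[OF assms] matrix_left_right_inverse by blast

lemma metric_invertible:
  assumes "riemannian_metric_on U g" "p \<in> U"
  shows "invertible (g p)"
proof -
  have "v = 0" if "g p *v v = 0" for v
  proof (rule ccontr)
    assume "v \<noteq> 0"
    then have "0 < metric_inner g p v v" using assms by (auto simp: riemannian_metric_on_def)
    also have "metric_inner g p v v = v \<bullet> (g p *v v)"
      by (simp add: metric_inner_def inner_vec_def matrix_vector_mult_def sum_distrib_left mult_ac)
    finally show False using that by simp
  qed
  then show ?thesis by (metis invertible_left_inverse matrix_left_invertible_ker)
qed

lemma frame_matrix_inv:
  fixes e :: "'n::finite \<Rightarrow> real ^ 'n"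
  assumes inv: "invertible (g p)"
    and on: "\<And>a b. metric_inner g p (e a) (e b) = (if a = b then 1 else 0)"
  shows "matrix_inv (g p) $ i $ j = (\<Sum>a\<in>UNIV. e a $ i * e a $ j)"
proof -
  define E where "E = (\<chi> a i. e a $ i)"
  have "E ** (g p ** transpose E) = mat 1"
    using on by (simp add: E_def matrix_matrix_mult_def transpose_def mat_def vec_eq_iff
      metric_inner_def sum_distrib_left mult_ac)
  then have "(g p ** transpose E) ** E = mat 1" by (simp add: matrix_left_right_inverse)
  then have *: "g p ** (transpose E ** E) = mat 1" by (simp add: matrix_mul_assoc)
  have "matrix_inv (g p) = matrix_inv (g p) ** (g p ** (transpose E ** E))"
    unfolding * by simp
  also have "\<dots> = transpose E ** E"
    using inv by (simp add: matrix_mul_assoc matrix_inv_left)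
  finally show ?thesis by (simp add: E_def matrix_matrix_mult_def transpose_def)
qed

lemma matrix_inv_cramer:
  fixes M :: "real ^ 'n::finite ^ 'n"
  assumes "invertible M"
  shows "matrix_inv M $ k $ l =
    det (\<chi> i j. if j = k then axis l 1 $ i else M $ i $ j) / det M"
proof -
  have d: "det M \<noteq> 0" using assms by (simp add: invertible_det_nz)
  have "M *v (matrix_inv M *v axis l 1) = axis l 1"
    using assms by (simp add: matrix_vector_mul_assoc matrix_inv_right)
  then have "matrix_inv M *v axis l 1 =
     (\<chi> k. det (\<chi> i j. if j = k then axis l 1 $ i else M $ i $ j) / det M)"
    using cramer[OF d] by blast
  moreover have "(matrix_inv M *v axis l 1) $ k = matrix_inv M $ k $ l"
    by (simp add: matrix_vector_mult_basis column_def)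
  ultimately show ?thesis by simp
qed

lemma differentiable_prod:
  fixes f :: "'i \<Rightarrow> 'a::real_normed_vector \<Rightarrow> real"
  assumes "finite S" "\<And>i. i \<in> S \<Longrightarrow> f i differentiable (at x)"
  shows "(\<lambda>x. \<Prod>i\<in>S. f i x) differentiable (at x)"
  using assms by (induction S rule: finite_induct) auto

lemma differentiable_component:
  assumes "F differentiable (at p)" shows "(\<lambda>q. F q $ i) differentiable (at p)"
  using assms bounded_linear.has_derivative[OF bounded_linear_vec_nth]
  unfolding differentiable_def by blast

lemma differentiable_det:
  fixes M :: "'a::real_normed_vector \<Rightarrow> real ^ 'n::finite ^ 'n"
  assumes "\<And>i j. (\<lambda>q. M q $ i $ j) differentiable (at p)"
  shows "(\<lambda>q. det (M q)) differentiable (at p)"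
  unfolding det_def using assms by (auto intro!: differentiable_sum differentiable_mult differentiable_prod)

lemma differentiable_matrix_inv:
  fixes M :: "'a::real_normed_vector \<Rightarrow> real ^ 'n::finite ^ 'n"
  assumes U: "open U" "p \<in> U" and inv: "\<And>q. q \<in> U \<Longrightarrow> invertible (M q)"
    and dM: "M differentiable (at p)"
  shows "(\<lambda>q. matrix_inv (M q) $ k $ l) differentiable (at p)"
proof -
  have c: "(\<lambda>q. M q $ i $ j) differentiable (at p)" for i j
    using dM by (intro differentiable_component)
  have c': "(\<lambda>q. if b then x else M q $ i $ j) differentiable (at p)" for b x i j
    using c by (cases b) auto
  have "det (M p) \<noteq> 0" using inv[OF U(2)] by (simp add: invertible_det_nz)
  then have "(\<lambda>q. det (\<chi> i j. if j = k then axis l 1 $ i else M q $ i $ j) / det (M q))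
      differentiable (at p)"
    by (intro differentiable_divide differentiable_det) (simp_all add: c c')
  then obtain D where D: "((\<lambda>q. det (\<chi> i j. if j = k then axis l 1 $ i else M q $ i $ j) / det (M q))
      has_derivative D) (at p)" by (auto simp: differentiable_def)
  show ?thesis unfolding differentiable_def
    by (rule exI, rule has_derivative_transform_within_open[OF D U])
       (simp add: matrix_inv_cramer[OF inv])
qed

lemma smooth_on_differentiable:
  assumes "smooth_on U F" "p \<in> U"
  shows "F differentiable (at p)" "(\<lambda>q. frechet_derivative F (at q) v) differentiable (at p)"
proof -
  have "higher_differentiable_on U F (Suc (Suc 0))" using assms unfolding smooth_on_def by blast
  then show "F differentiable (at p)" "(\<lambda>q. frechet_derivative F (at q) v) differentiable (at p)"
    using assms(2) by simp_all
qed

lemma differentiable_christoffel: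
  assumes U: "open U" "p \<in> U" and g: "riemannian_metric_on U g"
  shows "(\<lambda>q. christoffel g q k i j) differentiable (at p)"
proof -
  have sg: "smooth_on U g" using g by (simp add: riemannian_metric_on_def)
  have part: "(\<lambda>q. partial i (\<lambda>q. g q $ a $ b) q) differentiable (at p)" for i a b
  proof -
    obtain D where D: "((\<lambda>q. frechet_derivative g (at q) (axis i 1) $ a $ b) has_derivative D) (at p)"
      using differentiable_component[OF differentiable_component[OF smooth_on_differentiable(2)[OF sg U(2)]]]
      unfolding differentiable_def by blast
    have e: "partial i (\<lambda>q. g q $ a $ b) q = frechet_derivative g (at q) (axis i 1) $ a $ b"
      if "q \<in> U" for q
    proof -
      have "(g has_derivative frechet_derivative g (at q)) (at q)"
        using smooth_on_differentiable(1)[OF sg that] frechet_derivative_works by blast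
      then have "((\<lambda>q. g q $ a $ b) has_derivative (\<lambda>v. frechet_derivative g (at q) v $ a $ b)) (at q)"
        by (intro bounded_linear.has_derivative[OF bounded_linear_vec_nth])
      then show ?thesis by (simp add: partial_def frechet_derivative_at[symmetric])
    qed
    show ?thesis unfolding differentiable_def
      by (rule exI, rule has_derivative_transform_within_open[OF D U]) (simp add: e)
  qed
  show ?thesis unfolding christoffel_def
    by (intro differentiable_mult differentiable_const differentiable_sum differentiable_add
        differentiable_diff part ballI finite
        differentiable_matrix_inv[OF U metric_invertible[OF g] smooth_on_differentiable(1)[OF sg U(2)]])
qed

text \<open>The defining formula of the rough Laplacian in a smooth orthonormal frame on \<open>U\<close>; since
  all operators are local, \<open>U\<close> may be any open subset of the chart.\<close>

lemma rough_laplacian_orthonormal_frame: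
  fixes g :: "'n::finite metric" and e :: "'n \<Rightarrow> 'n vfield"
  assumes U: "open U" "p \<in> U" and g: "riemannian_metric_on U g" and X: "smooth_on U X"
    and e: "\<And>a. smooth_on U (e a)"
    and on: "\<And>q a b. q \<in> U \<Longrightarrow> metric_inner g q (e a q) (e b q) = (if a = b then 1 else 0)"
  shows "rough_laplacian g X p = (\<Sum>a\<in>UNIV. levi_civita g (e a) (levi_civita g (e a) X) p
     - levi_civita g (levi_civita g (e a) (e a)) X p)"
proof -
  have dX: "X differentiable (at q)" if "q \<in> U" for q using smooth_on_differentiable(1)[OF X that] .
  have "(\<lambda>q. \<chi> k. \<Sum>i\<in>UNIV. \<Sum>l\<in>UNIV. christoffel g q k i l * axis j 1 $ i * X q $ l)
     differentiable (at p)" for j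
    by (rule iffD2[OF differentiable_componentwise_within])
       (auto simp: Basis_vec_def inner_axis intro!: differentiable_sum differentiable_mult
         differentiable_christoffel[OF U g] differentiable_component[OF dX[OF U(2)]])
  then have A: "levi_civita g (coord_field j) X differentiable (at p)" for j
    unfolding levi_civita_def coord_field_def
    by (intro differentiable_add smooth_on_differentiable(2)[OF X U(2)])
  have "(\<Sum>a\<in>UNIV. second_cov g (e a) (e a) X p) =
    (\<Sum>a\<in>UNIV. \<Sum>i\<in>UNIV. \<Sum>j\<in>UNIV.
     (e a p $ i * e a p $ j) *\<^sub>R second_cov g (coord_field i) (coord_field j) X p)"
    by (intro sum.cong refl second_cov_coord[OF U dX A smooth_on_differentiable(1)[OF e U(2)]])
  also have "\<dots> = (\<Sum>i\<in>UNIV. \<Sum>j\<in>UNIV. \<Sum>a\<in>UNIV.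
     (e a p $ i * e a p $ j) *\<^sub>R second_cov g (coord_field i) (coord_field j) X p)"
    by (rule trans[OF sum.swap]) (rule sum.cong[OF refl sum.swap])
  also have "\<dots> = rough_laplacian g X p"
    unfolding rough_laplacian_def frame_matrix_inv[where e = "\<lambda>a. e a p", OF metric_invertible[OF g U(2)] on[OF U(2)]]
    by (simp add: scaleR_sum_left)
  finally show ?thesis by (simp add: second_cov_def)
qed

end

theory Submission
  imports Defs
begin

text \<open>For a metric $E(u)\,du^2 + G(u)\,dv^2$ put $c = \Gamma^2_{12} = G'/(2G)$ and
  $a = \Gamma^1_{11} = E'/(2E)$. Then
  $\Delta\partial_v = E^{-1}(c' + c^2 - ac)\,\partial_v = -K\,\partial_v$,
  so harmonicity of $\partial_v$ alone is equivalent to flatness.\<close>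

text \<open>The surface of revolution enters only through \<open>E\<close> $= f'^2 + h'^2$ and
  \<open>G\<close> $= f^2$. The curvature needs one derivative of \<open>E\<close> and two of
  \<open>G\<close>, so these are parameters in place of iterated \<open>deriv\<close> terms.\<close>

locale rotational_metric =
  fixes I :: "real set" and E G E' G' G'' :: "real \<Rightarrow> real"
    and U :: "(real ^ 2) set" and g :: "2 metric"
  assumes open_U: "open U"
    and U_I: "p \<in> U \<Longrightarrow> p $ 1 \<in> I"
    and g_eq: "p \<in> U \<Longrightarrow> g p = vector [vector [E (p $ 1), 0], vector [0, G (p $ 1)]]"
    and E_pos: "u \<in> I \<Longrightarrow> 0 < E u"
    and G_pos: "u \<in> I \<Longrightarrow> 0 < G u"
    and E_deriv: "u \<in> I \<Longrightarrow> (E has_real_derivative E' u) (at u)"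
    and G_deriv: "u \<in> I \<Longrightarrow> (G has_real_derivative G' u) (at u)"
    and G'_deriv: "u \<in> I \<Longrightarrow> (G' has_real_derivative G'' u) (at u)"
begin

lemma matrix_inv_metric:
  assumes "p \<in> U"
  shows "matrix_inv (g p) = vector [vector [1 / E (p $ 1), 0], vector [0, 1 / G (p $ 1)]]"
    (is "_ = ?N")
proof -
  have "E (p $ 1) \<noteq> 0" "G (p $ 1) \<noteq> 0"
    using E_pos[OF U_I[OF assms]] G_pos[OF U_I[OF assms]] by auto
  then have *: "g p ** ?N = mat 1"
    by (simp add: g_eq[OF assms] matrix_matrix_mult_def vec_eq_iff forall_2 sum_2 mat_def)
  then have "invertible (g p)"
    using matrix_left_right_inverse invertible_def by blast
  \<comment> \<open>\<open>matrix_inv\<close> is defined by choice, so it is identified by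
    cancelling it against the explicit right inverse \<open>?N\<close>.\<close>
  then have "matrix_inv (g p) ** (g p ** ?N) = ?N"
    by (simp add: matrix_mul_assoc matrix_inv_left)
  then show ?thesis using * by simp
qed

text \<open>On the open set \<open>U\<close> each entry is a function of $u$ alone, so the chain
  rule through the projection \<open>q $ 1\<close> leaves only $u$-derivatives of the
  diagonal.\<close>

lemma partial_metric:
  assumes "p \<in> U"
  shows "partial i (\<lambda>q. g q $ j $ k) p =
    (if i = 1 \<and> j = k then if j = 1 then E' (p $ 1) else G' (p $ 1) else 0)"
proof -
  define D where "D = (if j = k then if j = 1 then E' (p $ 1) else G' (p $ 1) else 0)"
  \<comment> \<open>\<open>s\<close> is the entry with indices \<open>j\<close>, \<open>k\<close> as
    a function of $u$, and \<open>D\<close> is its derivative; this treats all entries at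
    once.\<close>
  define s where "s = (\<lambda>u. if j = k then if j = 1 then E u else G u else 0)"
  have c: "((\<lambda>q::real^2. q $ 1) has_derivative (\<lambda>w. w $ 1)) (at p)"
    by (intro bounded_linear_imp_has_derivative bounded_linear_vec_nth)
  have "(s has_real_derivative D) (at (p $ 1))"
    using E_deriv[OF U_I[OF assms]] G_deriv[OF U_I[OF assms]] by (auto simp: s_def D_def)
  then have "((\<lambda>q. s (q $ 1)) has_derivative (\<lambda>w. D * w $ 1)) (at p)"
    unfolding has_field_derivative_def by (rule has_derivative_compose[OF c])
  then have "((\<lambda>q. g q $ j $ k) has_derivative (\<lambda>w. D * w $ 1)) (at p)"
    by (rule has_derivative_transform_within_open[OF _ open_U assms])
       (use exhaust_2[of j] exhaust_2[of k] in \<open>auto simp: g_eq s_def\<close>)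
  then show ?thesis
    using exhaust_2[of i]
    by (auto simp: partial_def frechet_derivative_at[symmetric] axis_def D_def)
qed

lemma christoffel_eq:
  assumes "p \<in> U"
  shows "christoffel g p 1 1 1 = E' (p $ 1) / (2 * E (p $ 1))"
    and "christoffel g p 1 1 2 = 0" and "christoffel g p 1 2 1 = 0"
    and "christoffel g p 1 2 2 = - G' (p $ 1) / (2 * E (p $ 1))"
    and "christoffel g p 2 1 1 = 0"
    and "christoffel g p 2 1 2 = G' (p $ 1) / (2 * G (p $ 1))"
    and "christoffel g p 2 2 1 = G' (p $ 1) / (2 * G (p $ 1))"
    and "christoffel g p 2 2 2 = 0"
  by (simp_all add: christoffel_def sum_2 matrix_inv_metric[OF assms] partial_metric[OF assms])

lemma levi_civita_scaled_coord_field: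
  assumes p: "p \<in> U" and s: "(s has_real_derivative s') (at (p $ 1))"
    and Y: "\<And>q. q \<in> U \<Longrightarrow> Y q = s (q $ 1) *\<^sub>R axis j 1"
  shows "levi_civita g X Y p = (X p $ 1 * s') *\<^sub>R axis j 1 +
    s (p $ 1) *\<^sub>R (\<chi> k. \<Sum>i\<in>UNIV. christoffel g p k i j * X p $ i)"
proof -
  have c: "((\<lambda>q::real^2. q $ 1) has_derivative (\<lambda>w. w $ 1)) (at p)"
    by (intro bounded_linear_imp_has_derivative bounded_linear_vec_nth)
  have "((\<lambda>q. s (q $ 1)) has_derivative (\<lambda>w. s' * w $ 1)) (at p)"
    using s unfolding has_field_derivative_def by (rule has_derivative_compose[OF c])
  then have "((\<lambda>q. s (q $ 1) *\<^sub>R axis j (1::real)) has_derivative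
      (\<lambda>w. (s' * w $ 1) *\<^sub>R axis j 1)) (at p)"
    by (rule has_derivative_scaleR_left)
  then have "(Y has_derivative (\<lambda>w. (s' * w $ 1) *\<^sub>R axis j 1)) (at p)"
    by (rule has_derivative_transform_within_open[OF _ open_U p]) (simp add: Y)
  then have "frechet_derivative Y (at p) (X p) = (X p $ 1 * s') *\<^sub>R axis j 1"
    by (simp add: frechet_derivative_at[symmetric])
  moreover have "(\<Sum>i\<in>UNIV. \<Sum>l\<in>UNIV. christoffel g p k i l * X p $ i * Y p $ l) =
      s (p $ 1) * (\<Sum>i\<in>UNIV. christoffel g p k i j * X p $ i)" for k
    using exhaust_2[of j] by (auto simp: Y[OF p] sum_2 axis_def algebra_simps)
  ultimately show ?thesis
    by (simp add: levi_civita_def vec_eq_iff)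
qed

lemma levi_civita_coord_field:
  assumes "p \<in> U"
  shows "levi_civita g X (coord_field j) p =
    (\<chi> k. \<Sum>i\<in>UNIV. christoffel g p k i j * X p $ i)"
  using levi_civita_scaled_coord_field[OF assms, of "\<lambda>_. 1" 0 "coord_field j" j X]
  by (simp add: coord_field_def)

lemma levi_civita_coord_fields:
  assumes "p \<in> U"
  shows "levi_civita g (coord_field 1) (coord_field 1) p =
      (E' (p $ 1) / (2 * E (p $ 1))) *\<^sub>R axis 1 1"
    and "levi_civita g (coord_field 1) (coord_field 2) p =
      (G' (p $ 1) / (2 * G (p $ 1))) *\<^sub>R axis 2 1"
    and "levi_civita g (coord_field 2) (coord_field 2) p =
      (- G' (p $ 1) / (2 * E (p $ 1))) *\<^sub>R axis 1 1"
  unfolding levi_civita_coord_field[OF assms]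
  by (simp_all add: vec_eq_iff forall_2 sum_2 christoffel_eq[OF assms] coord_field_def axis_def)

lemma rough_laplacian_coord_field_2:
  assumes p: "p \<in> U"
  shows "rough_laplacian g (coord_field 2) p = - gaussian_curvature g p *\<^sub>R axis 2 1"
proof -
  let ?u = "p $ 1"
  define e g1 e' g' g'' where "e = E ?u" and "g1 = G ?u" and "e' = E' ?u" and "g' = G' ?u"
    and "g'' = G'' ?u"
  note v = e_def[symmetric] g1_def[symmetric] e'_def[symmetric] g'_def[symmetric]
    g''_def[symmetric]
  have u: "?u \<in> I" by (rule U_I[OF p])
  have nz: "e \<noteq> 0" "g1 \<noteq> 0" using E_pos[OF u] G_pos[OF u] by (auto simp: e_def g1_def)
  define c' b' where "c' = (g'' * g1 - g' * g') / (2 * g1\<^sup>2)"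
    and "b' = - (g'' * e - g' * e') / (2 * e\<^sup>2)"
  have dc: "((\<lambda>u. G' u / (2 * G u)) has_real_derivative c') (at ?u)"
    using nz by (auto intro!: derivative_eq_intros G_deriv[OF u] G'_deriv[OF u]
      simp: v c'_def field_simps power2_eq_square)
  have db: "((\<lambda>u. - G' u / (2 * E u)) has_real_derivative b') (at ?u)"
    using nz by (auto intro!: derivative_eq_intros E_deriv[OF u] G'_deriv[OF u]
      simp: v b'_def field_simps power2_eq_square)
  have lc12: "levi_civita g X (levi_civita g (coord_field 1) (coord_field 2)) p =
      (X p $ 1 * c') *\<^sub>R axis 2 1 +
      (g' / (2 * g1)) *\<^sub>R (\<chi> k. \<Sum>i\<in>UNIV. christoffel g p k i 2 * X p $ i)" for X
    unfolding g'_def g1_def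
    by (rule levi_civita_scaled_coord_field[OF p dc levi_civita_coord_fields(2)])
  have lc22: "levi_civita g X (levi_civita g (coord_field 2) (coord_field 2)) p =
      (X p $ 1 * b') *\<^sub>R axis 1 1 +
      (- g' / (2 * e)) *\<^sub>R (\<chi> k. \<Sum>i\<in>UNIV. christoffel g p k i 1 * X p $ i)" for X
    unfolding g'_def e_def
    by (rule levi_civita_scaled_coord_field[OF p db levi_civita_coord_fields(3)])
  note lc = lc12 lc22 levi_civita_coord_field[OF p]
  define w where "w = c' + (g' / (2 * g1))\<^sup>2 - (e' / (2 * e)) * (g' / (2 * g1))"
  have "second_cov g (coord_field 1) (coord_field 1) (coord_field 2) p = w *\<^sub>R axis 2 1"
    unfolding second_cov_def lc
    by (simp add: christoffel_eq[OF p] v w_def vec_eq_iff forall_2 sum_2 coord_field_def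
        axis_def power2_eq_square mult_ac)
  moreover have "second_cov g (coord_field 2) (coord_field 2) (coord_field 2) p = 0"
    unfolding second_cov_def lc
    by (simp add: christoffel_eq[OF p] v vec_eq_iff forall_2 sum_2 coord_field_def axis_def)
  ultimately have lap: "rough_laplacian g (coord_field 2) p = (w / e) *\<^sub>R axis 2 1"
    by (simp add: rough_laplacian_def sum_2 matrix_inv_metric[OF p] v)
  have "lie_bracket (coord_field 1) (coord_field 2) = (\<lambda>p::real^2. 0)"
    by (simp add: lie_bracket_def coord_field_def)
  then have "riemann_curvature g (coord_field 1) (coord_field 2) (coord_field 2) p =
      (b' - e' / (2 * e) * (g' / (2 * e)) + g' / (2 * g1) * (g' / (2 * e))) *\<^sub>R axis 1 1"
    unfolding riemann_curvature_def lc
    by (simp add: christoffel_eq[OF p] v vec_eq_iff forall_2 sum_2 coord_field_def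
        axis_def mult_ac)
  \<comment> \<open>The left side is $b' + ab - bc$. Since $b = -(G/E)c$ and $(G/E)' = (G/E)(2c -
    2a)$, it follows that $b' = -(G/E)(c' + 2c^2 - 2ac)$, and $ab - bc = -(G/E)(ac - c^2)$ completes
    the sum.\<close>
  also have "b' - e' / (2 * e) * (g' / (2 * e)) + g' / (2 * g1) * (g' / (2 * e)) = - (g1 / e) * w"
    using nz by (simp add: w_def b'_def c'_def field_simps power2_eq_square)
  finally have "gaussian_curvature g p = - (w / e)"
    using nz by (simp add: gaussian_curvature_def metric_inner_def sum_2 g_eq[OF p] v
      coord_field_def axis_def)
  then show ?thesis by (simp add: lap)
qed

end

text \<open>Smoothness is stated with Frechet derivatives in fixed directions; on the real line the
  direction \<open>1\<close> yields \<open>deriv\<close>, and openness of \<open>S\<close> carries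
  its differentiability over.\<close>

lemma smooth_on_real_derivatives:
  fixes f :: "real \<Rightarrow> real"
  assumes "open S" "smooth_on S f" "u \<in> S"
  shows "(f has_real_derivative deriv f u) (at u)"
    and "(deriv f has_real_derivative deriv (deriv f) u) (at u)"
proof -
  have d: "(f has_real_derivative deriv f x) (at x)" if "x \<in> S" for x
    using smooth_on_differentiable(1)[OF assms(2) that]
    by (simp add: DERIV_deriv_iff_real_differentiable)
  then show "(f has_real_derivative deriv f u) (at u)" using assms(3) .
  have e: "frechet_derivative f (at x) 1 = deriv f x" if "x \<in> S" for x
    using d[OF that] by (simp add: has_field_derivative_def frechet_derivative_at[symmetric])
  obtain D where D: "((\<lambda>x. frechet_derivative f (at x) 1) has_derivative D) (at u)"
    using smooth_on_differentiable(2)[OF assms(2,3)] unfolding differentiable_def by blast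
  have "(deriv f has_derivative D) (at u)"
    by (rule has_derivative_transform_within_open[OF D assms(1,3)]) (rule e)
  then show "(deriv f has_real_derivative deriv (deriv f) u) (at u)"
    unfolding DERIV_deriv_iff_real_differentiable differentiable_def by blast
qed

lemma open_revolution_domain:
  assumes "open I"
  shows "open (revolution_domain I)"
proof -
  have "revolution_domain I = (\<lambda>p. p $ 1) -` I \<inter> (\<lambda>p. p $ 2) -` {0<..<2 * pi}"
    by (auto simp: revolution_domain_def)
  then show ?thesis
    using assms by (auto intro!: open_Int open_vimage continuous_intros)
qed

theorem mainTheorem4:
  fixes I :: "real set" and f h :: "real \<Rightarrow> real"
  assumes "open I" and "is_interval I"
    and "smooth_on I f" and "smooth_on I h"
    and "\<forall>u\<in>I. f u \<noteq> 0"
    and "\<forall>u\<in>I. (deriv f u)\<^sup>2 + (deriv h u)\<^sup>2 > 0"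
    and "harmonic_section (revolution_domain I)
           (induced_metric (surface_of_revolution f h)) (coord_field 1)"
    and "harmonic_section (revolution_domain I)
           (induced_metric (surface_of_revolution f h)) (coord_field 2)"
  shows "\<forall>p\<in>revolution_domain I.
           gaussian_curvature (induced_metric (surface_of_revolution f h)) p = 0"
proof
  fix p assume p: "p \<in> revolution_domain I"
  note df = smooth_on_real_derivatives[OF assms(1,3)]
  note dh = smooth_on_real_derivatives[OF assms(1,4)]
  interpret rotational_metric I "\<lambda>u. (deriv f u)\<^sup>2 + (deriv h u)\<^sup>2" "\<lambda>u. (f u)\<^sup>2"
    "\<lambda>u. 2 * deriv f u * deriv (deriv f) u + 2 * deriv h u * deriv (deriv h) u"
    "\<lambda>u. 2 * f u * deriv f u" "\<lambda>u. 2 * deriv f u * deriv f u + 2 * f u * deriv (deriv f) u"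
    "revolution_domain I" "induced_metric (surface_of_revolution f h)"
  proof
    fix q assume "q \<in> revolution_domain I"
    then have q: "q $ 1 \<in> I" by (simp add: revolution_domain_def)
    then show "q $ 1 \<in> I" .
    show "induced_metric (surface_of_revolution f h) q =
        vector [vector [(deriv f (q $ 1))\<^sup>2 + (deriv h (q $ 1))\<^sup>2, 0], vector [0, (f (q $ 1))\<^sup>2]]"
      by (rule induced_metric_surface_of_revolution)
        (use smooth_on_differentiable(1) assms(3,4) q in blast)+
  qed (use assms(5,6) in \<open>auto intro!: open_revolution_domain assms(1) derivative_eq_intros df dh\<close>)
  have "rough_laplacian (induced_metric (surface_of_revolution f h)) (coord_field 2) p = 0"
    using assms(8) p by (simp add: harmonic_section_def)
  then show "gaussian_curvature (induced_metric (surface_of_revolution f h)) p = 0"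
    by (simp add: rough_laplacian_coord_field_2[OF p] axis_eq_0_iff)
qed

end
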